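(* Let $n\ge2$, let $f:\{0,1\}^n\times\{0,1\}^n\to\{0,1\}$ and let $\mu$ be a product distribution on $\{0,1\}^n\times\{0,1\}^n$. (1) $\mathsf{CC}^\mu_{0.49}(f)\le C\left(\left(\log\mathrm{srec}^\mu_{1/n^2,1/n^2}(f)\right)^2\log n + 1\right)$ for an absolute constant $C$. (2) If there is an integer $k\ge20$ and some $\delta\le 1/(3000(k+1)^4)$ with $\lceil 100\log\mathrm{srec}^\mu_{\delta,\delta}(f)\rceil\le k$, then $\mathsf{CC}^\mu_{0.49}(f)\le Ck^2$ for an absolute constant $C$.
   Context: A rectangle is $A\times B$ with $A\subseteq\mathcal X,B\subseteq\mathcal Y$. A distribution $\mu$ is product if $\mu(x,y)=\mu_X(x)\mu_Y(y)$. For a nonnegative function $\mu$ on $\mathcal X\times\mathcal Y$, write $\mu_z(R)=\mu(R\cap f^{-1}(z))$ and $\mu_z=\mu_z(\mathcal X\times\mathcal Y)$. $\mathrm{srec}^{z,\mu}_{\epsilon,\delta}(f)$ is the optimal value of the LP: minimize $\sum_R w_R$ over $w_R\ge0$ (one variable per rectangle) subject to $\sum_{(x,y)\in f^{-1}(z)}\mu(x,y)\sum_{R\ni(x,y)}w_R\ge(1-\epsilon)\mu_z$; $\sum_{R\ni(x,y)}w_R\le\delta$ for all $(x,y)\notin f^{-1}(z)$; $\sum_{R\ni(x,y)}w_R\le1$ for all $(x,y)$. $\mathrm{srec}^\mu_{\epsilon,\delta}(f)=\max_{z\in\{0,1\}}\mathrm{srec}^{z,\mu}_{\epsilon,\delta}(f)$.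 $\mathsf{CC}^\mu_\epsilon(f)$ is the minimum worst-case communication of a deterministic protocol computing $f$ with error at most $\epsilon$ under $\mu$. Logs base 2. *)

theory Defs
  imports Complex_Main
begin

definition cube :: "nat \<Rightarrow> bool list set" where
  "cube n = {xs. length xs = n}"

definition dom2 :: "nat \<Rightarrow> (bool list \<times> bool list) set" where
  "dom2 n = cube n \<times> cube n"

definition is_distribution :: "nat \<Rightarrow> (bool list \<times> bool list \<Rightarrow> real) \<Rightarrow> bool" where
  "is_distribution n \<mu> \<longleftrightarrow> (\<forall>p\<in>dom2 n. 0 \<le> \<mu> p) \<and> (\<Sum>p\<in>dom2 n. \<mu> p) = 1"

definition is_product_distribution :: "nat \<Rightarrow> (bool list \<times> bool list \<Rightarrow> real) \<Rightarrow> bool" where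
  "is_product_distribution n \<mu> \<longleftrightarrow> is_distribution n \<mu> \<and>
     (\<exists>\<mu>X \<mu>Y :: bool list \<Rightarrow> real.
        (\<forall>x\<in>cube n. 0 \<le> \<mu>X x) \<and> (\<Sum>x\<in>cube n. \<mu>X x) = 1 \<and>
        (\<forall>y\<in>cube n. 0 \<le> \<mu>Y y) \<and> (\<Sum>y\<in>cube n. \<mu>Y y) = 1 \<and>
        (\<forall>x\<in>cube n. \<forall>y\<in>cube n. \<mu> (x, y) = \<mu>X x * \<mu>Y y))"

definition rects :: "nat \<Rightarrow> (bool list set \<times> bool list set) set" where
  "rects n = {(A, B). A \<subseteq> cube n \<and> B \<subseteq> cube n}"

definition inrect :: "bool list \<times> bool list \<Rightarrow> bool list set \<times> bool list set \<Rightarrow> bool" where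
  "inrect p R \<longleftrightarrow> fst p \<in> fst R \<and> snd p \<in> snd R"

definition cover :: "nat \<Rightarrow> (bool list set \<times> bool list set \<Rightarrow> real) \<Rightarrow> bool list \<times> bool list \<Rightarrow> real" where
  "cover n w p = (\<Sum>R\<in>{R\<in>rects n. inrect p R}. w R)"

definition mu_z :: "nat \<Rightarrow> (bool list \<times> bool list \<Rightarrow> real) \<Rightarrow> (bool list \<times> bool list \<Rightarrow> bool) \<Rightarrow> bool \<Rightarrow> real" where
  "mu_z n \<mu> f z = (\<Sum>p\<in>{p\<in>dom2 n. f p = z}. \<mu> p)"

definition srec_feasible ::
  "nat \<Rightarrow> (bool list \<times> bool list \<Rightarrow> bool) \<Rightarrow> (bool list \<times> bool list \<Rightarrow> real) \<Rightarrow> bool \<Rightarrow> real \<Rightarrow> real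
     \<Rightarrow> (bool list set \<times> bool list set \<Rightarrow> real) \<Rightarrow> bool" where
  "srec_feasible n f \<mu> z \<epsilon> \<delta> w \<longleftrightarrow>
     (\<forall>R\<in>rects n. 0 \<le> w R) \<and>
     (\<Sum>p\<in>{p\<in>dom2 n. f p = z}. \<mu> p * cover n w p) \<ge> (1 - \<epsilon>) * mu_z n \<mu> f z \<and>
     (\<forall>p\<in>dom2 n. f p \<noteq> z \<longrightarrow> cover n w p \<le> \<delta>) \<and>
     (\<forall>p\<in>dom2 n. cover n w p \<le> 1)"

definition srec_z ::
  "nat \<Rightarrow> (bool list \<times> bool list \<Rightarrow> bool) \<Rightarrow> (bool list \<times> bool list \<Rightarrow> real) \<Rightarrow> bool \<Rightarrow> real \<Rightarrow> real \<Rightarrow> real" where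
  "srec_z n f \<mu> z \<epsilon> \<delta> = Inf {(\<Sum>R\<in>rects n. w R) | w. srec_feasible n f \<mu> z \<epsilon> \<delta> w}"

definition srec ::
  "nat \<Rightarrow> (bool list \<times> bool list \<Rightarrow> bool) \<Rightarrow> (bool list \<times> bool list \<Rightarrow> real) \<Rightarrow> real \<Rightarrow> real \<Rightarrow> real" where
  "srec n f \<mu> \<epsilon> \<delta> = max (srec_z n f \<mu> False \<epsilon> \<delta>) (srec_z n f \<mu> True \<epsilon> \<delta>)"

text \<open>Deterministic two-party protocols as protocol trees: at an internal node either
  Alice (who holds x) or Bob (who holds y) sends one bit computed from her/his input.\<close>
datatype protocol =
    Out bool
  | Alice "bool list \<Rightarrow> bool" protocol protocol
  | Bob "bool list \<Rightarrow> bool" protocol protocol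

fun run :: "protocol \<Rightarrow> bool list \<Rightarrow> bool list \<Rightarrow> bool" where
  "run (Out b) x y = b"
| "run (Alice g P0 P1) x y = (if g x then run P1 x y else run P0 x y)"
| "run (Bob h P0 P1) x y = (if h y then run P1 x y else run P0 x y)"

fun cost :: "protocol \<Rightarrow> nat" where
  "cost (Out b) = 0"
| "cost (Alice g P0 P1) = Suc (max (cost P0) (cost P1))"
| "cost (Bob h P0 P1) = Suc (max (cost P0) (cost P1))"

definition proto_error ::
  "nat \<Rightarrow> (bool list \<times> bool list \<Rightarrow> bool) \<Rightarrow> (bool list \<times> bool list \<Rightarrow> real) \<Rightarrow> protocol \<Rightarrow> real" where
  "proto_error n f \<mu> P = (\<Sum>p\<in>{p\<in>dom2 n. run P (fst p) (snd p) \<noteq> f p}. \<mu> p)"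

definition CC ::
  "nat \<Rightarrow> (bool list \<times> bool list \<Rightarrow> bool) \<Rightarrow> (bool list \<times> bool list \<Rightarrow> real) \<Rightarrow> real \<Rightarrow> nat" where
  "CC n f \<mu> \<epsilon> = (LEAST d. \<exists>P. cost P = d \<and> proto_error n f \<mu> P \<le> \<epsilon>)"

end

theory Submission
  imports Defs
begin

text \<open>
  Maintain a rectangle X x Y and a set F of 0-rectangles that still matter, where the 0- and
  1-rectangles carry the weights of feasible solutions of the two linear programs. While neither
  colour dominates, averaging yields a 1-rectangle R that occupies a fraction 1/exp(O(k)) of X x Y
  and is almost free of zeros; hence the 0-rectangles cover R with average weight O(\<delta>).
  As the measure is a product, most 0-rectangles S (by mass) lose a factor \<sigma> of about 1/k when either
  X is restricted to the rows of R or Y to its columns. If some quarter of the weight of F has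
  negligible mass, it is discarded; otherwise the statement by mass also holds by weight, so one of
  the two restrictions makes a quarter of the weight of F negligible. Either way the weight of F
  drops by a constant factor, which can happen only O(k) times. Missing the restriction shrinks the
  rectangle only by a factor 1 - 1/exp(O(k)), but a run of exp(O(k)) misses has negligible
  probability. The tree has exp(O(k^2)) leaves, so it can be balanced to depth O(k^2). The first bound
  follows from the second one, as sending all of x costs only n + 1 bits when n = O(k^2).
\<close>

section \<open>Balancing protocol trees\<close>

fun leaves :: "protocol \<Rightarrow> nat" where
  "leaves (Out b) = 1"
| "leaves (Alice g P0 P1) = leaves P0 + leaves P1"
| "leaves (Bob h P0 P1) = leaves P0 + leaves P1"

lemma leaves_pos: "0 < leaves P"
  by (induction P) auto

text \<open>Descending into a child with more than \<open>m\<close> leaves must end at a node both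
  of whose children have at most \<open>m\<close>. The larger child is \<open>S\<close>; as the two
  together exceed \<open>m\<close>, it has more than half of \<open>m\<close>. \<open>P'\<close> is
  the tree with \<open>S\<close> cut off and its parent replaced by the sibling. The inputs reaching
  a node form a rectangle, so \<open>a\<close> and \<open>b\<close> can be tested separately by the
  two players.\<close>

lemma protocol_separator:
  assumes "1 \<le> m" "m < leaves P"
  shows "\<exists>a b S P'. leaves S \<le> m \<and> m < 2 * leaves S \<and> leaves P' + leaves S = leaves P \<and>
           (\<forall>x y. run P x y = (if a x \<and> b y then run S x y else run P' x y))"
  using assms
proof (induction P)
  case (Out c)
  then show ?case by simp
next
  case (Alice g P0 P1)
  consider "m < leaves P0" | "m < leaves P1"
    | "leaves P0 \<le> m" "leaves P1 \<le> m" "leaves P0 \<le> leaves P1"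
    | "leaves P0 \<le> m" "leaves P1 \<le> m" "leaves P1 \<le> leaves P0"
    by linarith
  then show ?case
  proof cases
    case 1
    then obtain a b S P' where "leaves S \<le> m" "m < 2 * leaves S" "leaves P' + leaves S = leaves P0"
      "\<forall>x y. run P0 x y = (if a x \<and> b y then run S x y else run P' x y)"
      using Alice by blast
    then show ?thesis
      by (intro exI[of _ "\<lambda>x. \<not> g x \<and> a x"] exI[of _ b] exI[of _ S] exI[of _ "Alice g P' P1"]) auto
  next
    case 2
    then obtain a b S P' where "leaves S \<le> m" "m < 2 * leaves S" "leaves P' + leaves S = leaves P1"
      "\<forall>x y. run P1 x y = (if a x \<and> b y then run S x y else run P' x y)"
      using Alice by blast
    then show ?thesis
      by (intro exI[of _ "\<lambda>x. g x \<and> a x"] exI[of _ b] exI[of _ S] exI[of _ "Alice g P0 P'"]) auto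
  next
    case 3
    then show ?thesis using Alice.prems
      by (intro exI[of _ g] exI[of _ "\<lambda>_. True"] exI[of _ P1] exI[of _ P0]) auto
  next
    case 4
    then show ?thesis using Alice.prems
      by (intro exI[of _ "\<lambda>x. \<not> g x"] exI[of _ "\<lambda>_. True"] exI[of _ P0] exI[of _ P1]) auto
  qed
next
  case (Bob h P0 P1)
  consider "m < leaves P0" | "m < leaves P1"
    | "leaves P0 \<le> m" "leaves P1 \<le> m" "leaves P0 \<le> leaves P1"
    | "leaves P0 \<le> m" "leaves P1 \<le> m" "leaves P1 \<le> leaves P0"
    by linarith
  then show ?case
  proof cases
    case 1
    then obtain a b S P' where "leaves S \<le> m" "m < 2 * leaves S" "leaves P' + leaves S = leaves P0"
      "\<forall>x y. run P0 x y = (if a x \<and> b y then run S x y else run P' x y)"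
      using Bob by blast
    then show ?thesis
      by (intro exI[of _ a] exI[of _ "\<lambda>y. \<not> h y \<and> b y"] exI[of _ S] exI[of _ "Bob h P' P1"]) auto
  next
    case 2
    then obtain a b S P' where "leaves S \<le> m" "m < 2 * leaves S" "leaves P' + leaves S = leaves P1"
      "\<forall>x y. run P1 x y = (if a x \<and> b y then run S x y else run P' x y)"
      using Bob by blast
    then show ?thesis
      by (intro exI[of _ a] exI[of _ "\<lambda>y. h y \<and> b y"] exI[of _ S] exI[of _ "Bob h P0 P'"]) auto
  next
    case 3
    then show ?thesis using Bob.prems
      by (intro exI[of _ "\<lambda>_. True"] exI[of _ h] exI[of _ P1] exI[of _ P0]) auto
  next
    case 4
    then show ?thesis using Bob.prems
      by (intro exI[of _ "\<lambda>_. True"] exI[of _ "\<lambda>y. \<not> h y"] exI[of _ P0] exI[of _ P1]) auto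
  qed
qed

text \<open>Two bits decide whether the computation passes through the separating subtree.\<close>
lemma protocol_balance:
  assumes "leaves P * 2 ^ d \<le> 3 ^ d"
  shows "\<exists>Q. cost Q \<le> 2 * d \<and> (\<forall>x y. run Q x y = run P x y)"
  using assms
proof (induction d arbitrary: P)
  case 0
  then have "leaves P \<le> 1" by simp
  then obtain b where "P = Out b"
    using leaves_pos by (cases P) (auto simp: le_Suc_eq, (metis add_is_1 leaves_pos less_numeral_extra(3))+)
  then show ?case by (intro exI[of _ "Out b"]) simp
next
  case (Suc d)
  show ?case
  proof (cases "leaves P \<le> 1")
    case True
    then obtain b where "P = Out b"
      using leaves_pos by (cases P) (auto simp: le_Suc_eq, (metis add_is_1 leaves_pos less_numeral_extra(3))+)
    then show ?thesis by (intro exI[of _ "Out b"]) simp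
  next
    case False
    \<comment> \<open>Even after rounding, \<open>S\<close> gets more than one third and at most two
      thirds of the leaves, so \<open>S\<close> and \<open>P'\<close> both have at most two
      thirds.\<close>
    define m where "m = 2 * leaves P div 3"
    have "1 \<le> m" "m < leaves P" using False unfolding m_def by linarith+
    from protocol_separator[OF this] obtain a b S P' where
      S: "leaves S \<le> m" "m < 2 * leaves S" "leaves P' + leaves S = leaves P"
      and eq: "\<And>x y. run P x y = (if a x \<and> b y then run S x y else run P' x y)"
      by blast
    have "3 * leaves S \<le> 2 * leaves P" "3 * leaves P' \<le> 2 * leaves P"
      using S unfolding m_def by linarith+
    then have "3 * leaves S * 2 ^ d \<le> 2 * leaves P * 2 ^ d" "3 * leaves P' * 2 ^ d \<le> 2 * leaves P * 2 ^ d"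
      by simp_all
    moreover have "2 * leaves P * 2 ^ d \<le> 3 * 3 ^ d"
      using Suc.prems by (simp add: mult.assoc mult.left_commute)
    ultimately have "3 * (leaves S * 2 ^ d) \<le> 3 * 3 ^ d" "3 * (leaves P' * 2 ^ d) \<le> 3 * 3 ^ d"
      unfolding mult.assoc by (meson order_trans)+
    then have "leaves S * 2 ^ d \<le> 3 ^ d" "leaves P' * 2 ^ d \<le> 3 ^ d"
      by linarith+
    then obtain QS QP where Q: "cost QS \<le> 2 * d" "\<And>x y. run QS x y = run S x y"
      "cost QP \<le> 2 * d" "\<And>x y. run QP x y = run P' x y"
      using Suc.IH[of S] Suc.IH[of P'] by auto
    then show ?thesis
      by (intro exI[of _ "Alice a QP (Bob b QP QS)"]) (auto simp: eq)
  qed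
qed

lemma CC_le_cost:
  assumes "proto_error n f \<mu> P \<le> \<epsilon>"
  shows "CC n f \<mu> \<epsilon> \<le> cost P"
  unfolding CC_def by (rule Least_le) (use assms in blast)

text \<open>Two levels of balancing shrink the leaf bound by 4/9, which is less than 1/2 (this is 8
  < 9), so \<open>2 * e\<close> levels of two bits each suffice.\<close>

lemma CC_le_leaves:
  assumes "proto_error n f \<mu> P \<le> \<epsilon>" "leaves P \<le> 2 ^ e"
  shows "CC n f \<mu> \<epsilon> \<le> 4 * e"
proof -
  have "leaves P * 2 ^ (2 * e) \<le> 2 ^ e * 2 ^ (2 * e)"
    using assms(2) by simp
  also have "\<dots> = (8::nat) ^ e"
    by (simp add: power_mult flip: power_mult_distrib)
  also have "\<dots> \<le> 9 ^ e" by (simp add: power_mono)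
  finally have "leaves P * 2 ^ (2 * e) \<le> 3 ^ (2 * e)"
    by (simp add: power_mult)
  from protocol_balance[OF this] obtain Q where
    Q: "cost Q \<le> 2 * (2 * e)" "\<And>x y. run Q x y = run P x y" by blast
  have "proto_error n f \<mu> Q \<le> \<epsilon>"
    using assms(1) by (simp add: proto_error_def Q)
  from CC_le_cost[OF this] Q(1) show ?thesis by simp
qed

text \<open>Alice sends \<open>j\<close> bits and Bob, who then knows the prefix, sends the value.
  The bit at position \<open>j\<close> goes first and is absorbed into \<open>g\<close>, which is
  why \<open>g\<close> varies in the induction.\<close>

lemma exact_protocol:
  "\<exists>P. cost P \<le> Suc j \<and> (\<forall>x y. j \<le> length x \<longrightarrow> run P x y = g (take j x) y)"
proof (induction j arbitrary: g)
  case 0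
  show ?case
    by (intro exI[of _ "Bob (g []) (Out False) (Out True)"]) auto
next
  case (Suc j)
  obtain P0 P1 where
    "cost P0 \<le> Suc j" "\<And>x y. j \<le> length x \<Longrightarrow> run P0 x y = g (take j x @ [False]) y"
    "cost P1 \<le> Suc j" "\<And>x y. j \<le> length x \<Longrightarrow> run P1 x y = g (take j x @ [True]) y"
    using Suc.IH[of "\<lambda>u. g (u @ [False])"] Suc.IH[of "\<lambda>u. g (u @ [True])"] by blast
  then show ?case
    by (intro exI[of _ "Alice (\<lambda>x. x ! j) P0 P1"]) (auto simp: take_Suc_conv_app_nth)
qed

lemma CC_le_Suc_n:
  assumes "0 \<le> \<epsilon>"
  shows "CC n f \<mu> \<epsilon> \<le> Suc n"
proof -
  obtain P where P: "cost P \<le> Suc n"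
    "\<And>x y. n \<le> length x \<Longrightarrow> run P x y = f (take n x, y)"
    using exact_protocol[of n "\<lambda>x y. f (x, y)"] by auto
  have "{p \<in> dom2 n. run P (fst p) (snd p) \<noteq> f p} = {}"
    using P(2) by (auto simp: dom2_def cube_def)
  then have "proto_error n f \<mu> P \<le> \<epsilon>"
    using assms by (simp only: proto_error_def sum.empty)
  from CC_le_cost[OF this] P(1) show ?thesis by simp
qed

section \<open>Integration over rectangles\<close>

lemma finite_cube: "finite (cube n)"
  using finite_lists_length_eq[of "UNIV :: bool set" n] by (simp add: cube_def)

lemma finite_rects: "finite (rects n)"
  by (rule finite_subset[of _ "Pow (cube n) \<times> Pow (cube n)"]) (auto simp: rects_def finite_cube)

locale product_measure =
  fixes n :: nat and \<mu>X \<mu>Y :: "bool list \<Rightarrow> real"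
  assumes \<mu>X_nonneg: "x \<in> cube n \<Longrightarrow> 0 \<le> \<mu>X x"
    and \<mu>Y_nonneg: "y \<in> cube n \<Longrightarrow> 0 \<le> \<mu>Y y"
begin

definition integ :: "(bool list \<times> bool list \<Rightarrow> real) \<Rightarrow> bool list set \<Rightarrow> bool list set \<Rightarrow> real" where
  "integ g X Y = (\<Sum>p\<in>X \<times> Y. \<mu>X (fst p) * \<mu>Y (snd p) * g p)"

definition mass :: "bool list set \<Rightarrow> bool list set \<Rightarrow> real" where
  "mass X Y = sum \<mu>X X * sum \<mu>Y Y"

lemma integ_add: "integ (\<lambda>p. g p + h p) X Y = integ g X Y + integ h X Y"
  by (simp add: integ_def distrib_left sum.distrib)

lemma integ_scale: "integ (\<lambda>p. c * g p) X Y = c * integ g X Y"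
  by (simp add: integ_def sum_distrib_left mult.left_commute)

lemma integ_sum: "integ (\<lambda>p. \<Sum>i\<in>G. h i p) X Y = (\<Sum>i\<in>G. integ (h i) X Y)"
  unfolding integ_def by (subst sum.swap) (simp add: sum_distrib_left)

lemma integ_const: "integ (\<lambda>_. c) X Y = c * mass X Y"
proof -
  have "mass X Y = (\<Sum>p\<in>X \<times> Y. \<mu>X (fst p) * \<mu>Y (snd p))"
    by (simp add: mass_def sum_product sum.cartesian_product case_prod_unfold)
  then show ?thesis
    by (simp add: integ_def sum_distrib_left mult.commute)
qed

lemma integ_cong: "(\<And>p. p \<in> X \<times> Y \<Longrightarrow> g p = h p) \<Longrightarrow> integ g X Y = integ h X Y"
  unfolding integ_def by (rule sum.cong) auto

lemma integ_mono:
  assumes "X \<subseteq> cube n" "Y \<subseteq> cube n" "\<And>p. p \<in> dom2 n \<Longrightarrow> g p \<le> h p"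
  shows "integ g X Y \<le> integ h X Y"
  unfolding integ_def
  by (rule sum_mono, rule mult_left_mono)
    (use assms in \<open>auto simp: dom2_def intro!: assms(3) mult_nonneg_nonneg \<mu>X_nonneg \<mu>Y_nonneg\<close>)

lemma integ_nonneg:
  assumes "X \<subseteq> cube n" "Y \<subseteq> cube n" "\<And>p. p \<in> dom2 n \<Longrightarrow> 0 \<le> g p"
  shows "0 \<le> integ g X Y"
  using integ_mono[of X Y "\<lambda>_. 0" g] assms by (simp add: integ_const)

lemma integ_split_left:
  assumes "X \<subseteq> cube n" "Y \<subseteq> cube n"
  shows "integ g X Y = integ g (X \<inter> A) Y + integ g (X - A) Y"
proof -
  have "X \<times> Y = (X \<inter> A) \<times> Y \<union> (X - A) \<times> Y" by auto
  moreover have "finite X" "finite Y" using assms finite_cube finite_subset by blast+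
  ultimately show ?thesis
    unfolding integ_def by (simp only:) (rule sum.union_disjoint, auto)
qed

lemma integ_split_right:
  assumes "X \<subseteq> cube n" "Y \<subseteq> cube n"
  shows "integ g X Y = integ g X (Y \<inter> B) + integ g X (Y - B)"
proof -
  have "X \<times> Y = X \<times> (Y \<inter> B) \<union> X \<times> (Y - B)" by auto
  moreover have "finite X" "finite Y" using assms finite_cube finite_subset by blast+
  ultimately show ?thesis
    unfolding integ_def by (simp only:) (rule sum.union_disjoint, auto)
qed

lemma integ_rect:
  assumes "X \<subseteq> cube n" "Y \<subseteq> cube n"
  shows "integ (\<lambda>p. of_bool (inrect p R) * g p) X Y = integ g (X \<inter> fst R) (Y \<inter> snd R)"
proof -
  have "finite X" "finite Y" using assms finite_cube finite_subset by blast+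
  then show ?thesis
    unfolding integ_def
    by (intro sum.mono_neutral_cong_right) (auto simp: inrect_def)
qed

lemma sum_\<mu>X_nonneg: "X \<subseteq> cube n \<Longrightarrow> 0 \<le> sum \<mu>X X"
  by (rule sum_nonneg) (use \<mu>X_nonneg in auto)

lemma sum_\<mu>Y_nonneg: "Y \<subseteq> cube n \<Longrightarrow> 0 \<le> sum \<mu>Y Y"
  by (rule sum_nonneg) (use \<mu>Y_nonneg in auto)

lemma sum_\<mu>X_Int_le: "X \<subseteq> cube n \<Longrightarrow> sum \<mu>X (X \<inter> A) \<le> sum \<mu>X X"
  by (rule sum_mono2) (use \<mu>X_nonneg finite_cube in \<open>auto intro: finite_subset\<close>)

lemma sum_\<mu>Y_Int_le: "Y \<subseteq> cube n \<Longrightarrow> sum \<mu>Y (Y \<inter> B) \<le> sum \<mu>Y Y"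
  by (rule sum_mono2) (use \<mu>Y_nonneg finite_cube in \<open>auto intro: finite_subset\<close>)

lemma mass_nonneg: "X \<subseteq> cube n \<Longrightarrow> Y \<subseteq> cube n \<Longrightarrow> 0 \<le> mass X Y"
  by (simp add: mass_def sum_\<mu>X_nonneg sum_\<mu>Y_nonneg)

lemma mass_split_left: "X \<subseteq> cube n \<Longrightarrow> Y \<subseteq> cube n \<Longrightarrow> mass X Y = mass (X \<inter> A) Y + mass (X - A) Y"
  using integ_split_left[of X Y "\<lambda>_. 1" A] by (simp add: integ_const)

lemma mass_split_right: "X \<subseteq> cube n \<Longrightarrow> Y \<subseteq> cube n \<Longrightarrow> mass X Y = mass X (Y \<inter> B) + mass X (Y - B)"
  using integ_split_right[of X Y "\<lambda>_. 1" B] by (simp add: integ_const)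

end

section \<open>The recursive protocol\<close>

text \<open>\<open>w z\<close> is to be a feasible solution for colour \<open>z\<close>, with slack
  \<open>D\<close> on the other colour and total weight at most \<open>V\<close>. A usable rectangle
  occupies at least the fraction \<kappa>; after a hit, the discarded cover is at most the fraction
  \<sigma>; without a cut, a cover of at most the fraction \<eta> may be discarded. \<gamma> is the
  price of one weight-reducing step and \<open>T\<close> the number of misses allowed after a hit.
  \<open>\<eta>_le\<close> and \<open>T_large\<close> say that the price pays for a discard and for
  a hit.\<close>

locale smooth_cover = product_measure +
  fixes f :: "bool list \<times> bool list \<Rightarrow> bool"
    and w :: "bool \<Rightarrow> bool list set \<times> bool list set \<Rightarrow> real"
    and D V \<kappa> \<sigma> \<eta> \<gamma> :: real and T :: nat
  assumes w_nonneg: "R \<in> rects n \<Longrightarrow> 0 \<le> w z R"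
    and cover_le_1: "p \<in> dom2 n \<Longrightarrow> cover n (w z) p \<le> 1"
    and cover_le_D: "p \<in> dom2 n \<Longrightarrow> f p \<noteq> z \<Longrightarrow> cover n (w z) p \<le> D"
    and w_sum: "sum (w z) (rects n) \<le> V"
    and D_pos: "0 < D" and V_pos: "0 < V" and \<sigma>_pos: "0 < \<sigma>"
    and \<kappa>_eq: "\<kappa> = 1 / (20 * V)" and \<kappa>_le_1: "\<kappa> \<le> 1"
    and D_le: "6 * D \<le> \<eta> * \<sigma>\<^sup>2"
    and \<eta>_le: "5 * \<eta> \<le> \<gamma>"
    and T_large: "5 * \<sigma> + (1 - \<kappa>) ^ T \<le> \<gamma>"
begin

lemma \<kappa>_pos: "0 < \<kappa>"
  using V_pos by (simp add: \<kappa>_eq)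

section \<open>Covered, lost and misclassified mass\<close>

definition cov :: "(bool list set \<times> bool list set) set \<Rightarrow> bool list \<times> bool list \<Rightarrow> real" where
  "cov G p = (\<Sum>R\<in>G. w False R * of_bool (inrect p R))"

text \<open>The mass of colour \<open>z\<close> left uncovered. It is additive under cuts, and on
  the whole cube the first constraint of the linear program bounds it by \<open>D\<close> times the
  mass of the colour.\<close>

definition loss :: "bool \<Rightarrow> bool list set \<Rightarrow> bool list set \<Rightarrow> real" where
  "loss z = integ (\<lambda>p. of_bool (f p = z) * (1 - cover n (w z) p))"

definition color :: "bool \<Rightarrow> bool list set \<Rightarrow> bool list set \<Rightarrow> real" where
  "color z = integ (\<lambda>p. of_bool (f p = z))"

definition err :: "protocol \<Rightarrow> bool list set \<Rightarrow> bool list set \<Rightarrow> real" where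
  "err P = integ (\<lambda>p. of_bool (run P (fst p) (snd p) \<noteq> f p))"

lemma cover_alt: "cover n u p = (\<Sum>R\<in>rects n. u R * of_bool (inrect p R))"
  unfolding cover_def by (simp add: sum.inter_filter finite_rects of_bool_def if_distrib cong: if_cong)

lemma cov_rects: "cov (rects n) p = cover n (w False) p"
  by (simp add: cov_def cover_alt)

lemma integ_cover:
  assumes "X \<subseteq> cube n" "Y \<subseteq> cube n"
  shows "integ (\<lambda>p. g p * cover n u p) X Y = (\<Sum>R\<in>rects n. u R * integ g (X \<inter> fst R) (Y \<inter> snd R))"
proof -
  have "(\<lambda>p. g p * cover n u p) = (\<lambda>p. \<Sum>R\<in>rects n. u R * (of_bool (inrect p R) * g p))"
    by (auto simp: cover_alt sum_distrib_left intro!: sum.cong)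
  then show ?thesis by (simp add: integ_sum integ_scale integ_rect assms)
qed

lemma integ_cov:
  assumes "X \<subseteq> cube n" "Y \<subseteq> cube n"
  shows "integ (cov G) X Y = (\<Sum>R\<in>G. w False R * mass (X \<inter> fst R) (Y \<inter> snd R))"
proof -
  have "cov G = (\<lambda>p. \<Sum>R\<in>G. w False R * (of_bool (inrect p R) * 1))"
    by (auto simp: cov_def)
  then show ?thesis by (simp only: integ_sum integ_scale integ_rect[OF assms] integ_const mult_1)
qed

lemma integ_cov_mono:
  assumes "X \<subseteq> cube n" "Y \<subseteq> cube n" "G \<subseteq> G'" "G' \<subseteq> rects n"
  shows "integ (cov G) X Y \<le> integ (cov G') X Y"
  unfolding integ_cov[OF assms(1,2)]
proof (rule sum_mono2)
  show "finite G'" using assms(4) finite_rects finite_subset by blast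
  fix R assume "R \<in> G' - G"
  then have "0 \<le> w False R" using assms w_nonneg by blast
  moreover have "0 \<le> mass (X \<inter> fst R) (Y \<inter> snd R)" using assms by (intro mass_nonneg) auto
  ultimately show "0 \<le> w False R * mass (X \<inter> fst R) (Y \<inter> snd R)" by simp
qed (use assms in auto)

lemma integ_cov_le_mass:
  assumes "X \<subseteq> cube n" "Y \<subseteq> cube n" "G \<subseteq> rects n"
  shows "integ (cov G) X Y \<le> mass X Y"
proof -
  have "integ (cov G) X Y \<le> integ (cov (rects n)) X Y"
    using assms by (intro integ_cov_mono) auto
  also have "\<dots> \<le> integ (\<lambda>_. 1) X Y"
    using assms cover_le_1 by (intro integ_mono) (auto simp: cov_rects)
  finally show ?thesis by (simp add: integ_const)
qed

lemma integ_cov_nonneg: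
  assumes "X \<subseteq> cube n" "Y \<subseteq> cube n" "G \<subseteq> rects n"
  shows "0 \<le> integ (cov G) X Y"
  using integ_cov_mono[of X Y "{}" G] assms by (simp add: integ_cov)

text \<open>The cover by \<open>rects n - F\<close> is the dead part charged by \<open>bad\<close>;
  discarding \<open>G\<close> adds exactly the cover by \<open>G\<close> to it.\<close>

lemma integ_cov_Un:
  assumes "X \<subseteq> cube n" "Y \<subseteq> cube n" "G \<subseteq> F" "F \<subseteq> rects n"
  shows "integ (cov (rects n - (F - G))) X Y = integ (cov (rects n - F)) X Y + integ (cov G) X Y"
proof -
  have "rects n - (F - G) = (rects n - F) \<union> G" using assms by auto
  moreover have "finite (rects n - F)" "finite G"
    using finite_rects finite_subset[of G "rects n"] assms by auto
  ultimately show ?thesis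
    unfolding integ_cov[OF assms(1,2)] by (simp only:) (rule sum.union_disjoint, use assms in auto)
qed

lemma integ_cov_compl:
  assumes "X \<subseteq> cube n" "Y \<subseteq> cube n" "F \<subseteq> rects n"
  shows "integ (cover n (w False)) X Y = integ (cov (rects n - F)) X Y + integ (cov F) X Y"
  using integ_cov_Un[of X Y F F] assms by (simp add: cov_rects[abs_def])

lemma color_add:
  shows "color False X Y + color True X Y = mass X Y"
proof -
  have "color False X Y + color True X Y = integ (\<lambda>p. of_bool (f p = False) + of_bool (f p = True)) X Y"
    unfolding color_def by (simp add: integ_add)
  also have "\<dots> = integ (\<lambda>_. 1) X Y" by (rule integ_cong) auto
  finally show ?thesis by (simp add: integ_const)
qed

lemma color_nonneg: "X \<subseteq> cube n \<Longrightarrow> Y \<subseteq> cube n \<Longrightarrow> 0 \<le> color z X Y"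
  unfolding color_def by (rule integ_nonneg) auto

lemma loss_nonneg: "X \<subseteq> cube n \<Longrightarrow> Y \<subseteq> cube n \<Longrightarrow> 0 \<le> loss z X Y"
  unfolding loss_def using cover_le_1 by (intro integ_nonneg) auto

lemma color_eq_loss_plus:
  "color z X Y = loss z X Y + integ (\<lambda>p. of_bool (f p = z) * cover n (w z) p) X Y"
  unfolding color_def loss_def by (simp add: algebra_simps flip: integ_add)

lemma err_Out: "err (Out b) X Y = color (\<not> b) X Y"
  unfolding err_def color_def by (rule integ_cong) auto

lemma err_Alice:
  assumes "X \<subseteq> cube n" "Y \<subseteq> cube n"
  shows "err (Alice (\<lambda>x. x \<in> A) P0 P1) X Y = err P1 (X \<inter> A) Y + err P0 (X - A) Y"
  unfolding err_def
  by (subst integ_split_left[OF assms, of _ A], rule arg_cong2[where f = "(+)"]; rule integ_cong) auto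

lemma err_Bob:
  assumes "X \<subseteq> cube n" "Y \<subseteq> cube n"
  shows "err (Bob (\<lambda>y. y \<in> B) P0 P1) X Y = err P1 X (Y \<inter> B) + err P0 X (Y - B)"
  unfolding err_def
  by (subst integ_split_right[OF assms, of _ B], rule arg_cong2[where f = "(+)"]; rule integ_cong) auto

section \<open>Progress on a rectangle with many ones\<close>

text \<open>Averaging over \<open>w True\<close>: the ones are well covered because
  \<open>loss True\<close> is small, the zeros are covered at most \<open>D\<close>, and asking for
  the fraction \<kappa> costs V * \<kappa> = 1/20 of the mass on average.\<close>

lemma exists_nearly_one_colored_rect:
  assumes XY: "X \<subseteq> cube n" "Y \<subseteq> cube n" and pos: "0 < mass X Y"
    and col: "12 / 25 * mass X Y < color True X Y" and ls: "5 * loss True X Y < mass X Y"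
  shows "\<exists>A B. \<kappa> * mass X Y \<le> mass (X \<inter> A) (Y \<inter> B) \<and>
               color False (X \<inter> A) (Y \<inter> B) \<le> 5 * D * color True (X \<inter> A) (Y \<inter> B)"
proof -
  define c where "c z R = color z (X \<inter> fst R) (Y \<inter> snd R)" for z R
  have c0: "0 \<le> c z R" for z R
    unfolding c_def using XY by (intro color_nonneg) auto
  have "7 / 25 * mass X Y \<le> integ (\<lambda>p. of_bool (f p = True) * cover n (w True) p) X Y"
    using color_eq_loss_plus[of True X Y] col ls by linarith
  then have one: "7 / 25 * mass X Y \<le> (\<Sum>R\<in>rects n. w True R * c True R)"
    unfolding c_def color_def by (subst (asm) integ_cover[OF XY])
  have "integ (\<lambda>p. of_bool (f p = False) * cover n (w True) p) X Y \<le> integ (\<lambda>_. D) X Y"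
    using cover_le_D[of _ True] D_pos by (intro integ_mono XY) auto
  then have zero: "(\<Sum>R\<in>rects n. w True R * c False R) \<le> D * mass X Y"
    unfolding c_def color_def integ_const by (subst (asm) integ_cover[OF XY])
  have tot: "(\<Sum>R\<in>rects n. w True R * (\<kappa> * mass X Y)) \<le> V * (\<kappa> * mass X Y)"
    unfolding sum_distrib_right[symmetric]
    using w_sum \<kappa>_pos pos by (intro mult_right_mono) auto
  have "V * (\<kappa> * mass X Y) = mass X Y / 20" using V_pos by (simp add: \<kappa>_eq)
  \<comment> \<open>A positive \<open>h R\<close> yields both conclusions. The weighted sum of
    \<open>h\<close> is at least 7/25 - 1/5 - 1/20 > 0 times the mass, where 7/25 = 12/25 - 1/5
    bounds the covered ones from below.\<close>
  define h where "h R = c True R - c False R / (5 * D) - \<kappa> * mass X Y" for R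
  have "(\<Sum>R\<in>rects n. w True R * h R) = (\<Sum>R\<in>rects n. w True R * c True R)
      - (\<Sum>R\<in>rects n. w True R * c False R) / (5 * D) - (\<Sum>R\<in>rects n. w True R * (\<kappa> * mass X Y))"
    unfolding h_def by (simp add: right_diff_distrib sum_subtractf sum_divide_distrib)
  moreover have "(\<Sum>R\<in>rects n. w True R * c False R) / (5 * D) \<le> mass X Y / 5"
    using zero D_pos by (simp add: field_simps)
  ultimately have "0 < (\<Sum>R\<in>rects n. w True R * h R)"
    using one tot \<open>V * _ = _\<close> pos by linarith
  then obtain R where R: "R \<in> rects n" "0 < w True R * h R"
    by (meson not_le sum_nonpos)
  then have "0 < h R" using w_nonneg[of R True] by (simp add: zero_less_mult_iff)
  then have h: "c False R / (5 * D) + \<kappa> * mass X Y < c True R" unfolding h_def by simp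
  have "0 \<le> c False R / (5 * D)" using c0[of False R] D_pos by simp
  moreover have "c False R + c True R = mass (X \<inter> fst R) (Y \<inter> snd R)"
    unfolding c_def by (rule color_add)
  ultimately have "\<kappa> * mass X Y \<le> mass (X \<inter> fst R) (Y \<inter> snd R)"
    using h c0[of False R] by linarith
  moreover have "0 \<le> \<kappa> * mass X Y" using \<kappa>_pos pos by simp
  then have "c False R / (5 * D) \<le> c True R" using h by linarith
  then have "c False R \<le> 5 * D * c True R" using D_pos by (simp add: field_simps)
  ultimately show ?thesis unfolding c_def by blast
qed

text \<open>Ones are covered at most \<open>D\<close>; zeros are covered at most 1 but have at most
  5 * D times the mass of the ones.\<close>

lemma integ_cover_nearly_one_colored:
  assumes XY: "X \<subseteq> cube n" "Y \<subseteq> cube n"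
    and "color False X Y \<le> 5 * D * color True X Y"
  shows "integ (cover n (w False)) X Y \<le> 6 * D * mass X Y"
proof -
  have "integ (cover n (w False)) X Y \<le> integ (\<lambda>p. D * of_bool (f p = True) + of_bool (f p = False)) X Y"
    using cover_le_D[of _ False] cover_le_1[of _ False] D_pos by (intro integ_mono XY) auto
  also have "\<dots> = D * color True X Y + color False X Y"
    unfolding color_def by (simp add: integ_add integ_scale)
  also have "\<dots> \<le> 6 * D * color True X Y" using assms(3) by simp
  also have "\<dots> \<le> 6 * D * mass X Y"
    using color_add[of X Y] color_nonneg[OF XY, of False] D_pos by simp
  finally show ?thesis .
qed

text \<open>For a product measure, the share of a 0-rectangle in the nearly one-coloured rectangle
  is its share of the rows times its share of the columns. So a drop by \<sigma>^2 in that rectangle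
  forces a drop by \<sigma> on one side. The exceptions have little mass, and
  \<open>no_discard\<close> turns this into little weight.\<close>

lemma exists_progress:
  assumes XY: "X \<subseteq> cube n" "Y \<subseteq> cube n" and F: "F \<subseteq> rects n" and pos: "0 < mass X Y"
    and col: "12 / 25 * mass X Y < color True X Y" and ls: "5 * loss True X Y < mass X Y"
    and no_discard: "\<And>G. G \<subseteq> F \<Longrightarrow> sum (w False) F / 4 \<le> sum (w False) G \<Longrightarrow> \<eta> * mass X Y < integ (cov G) X Y"
  shows "(\<exists>A G. G \<subseteq> F \<and> sum (w False) F / 4 \<le> sum (w False) G \<and> \<kappa> * mass X Y \<le> mass (X \<inter> A) Y
              \<and> integ (cov G) (X \<inter> A) Y \<le> \<sigma> * mass (X \<inter> A) Y)
       \<or> (\<exists>B G. G \<subseteq> F \<and> sum (w False) F / 4 \<le> sum (w False) G \<and> \<kappa> * mass X Y \<le> mass X (Y \<inter> B)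
              \<and> integ (cov G) X (Y \<inter> B) \<le> \<sigma> * mass X (Y \<inter> B))"
proof -
  obtain A B where big: "\<kappa> * mass X Y \<le> mass (X \<inter> A) (Y \<inter> B)"
    and mono: "color False (X \<inter> A) (Y \<inter> B) \<le> 5 * D * color True (X \<inter> A) (Y \<inter> B)"
    using exists_nearly_one_colored_rect[OF XY pos col ls] by blast
  \<comment> \<open>\<open>a\<close> and \<open>b\<close> measure rows and columns; the suffix 1
    restricts to \<open>A\<close> or \<open>B\<close>, 0 to the 0-rectangle, and 01 to both.\<close>
  define a b a1 b1 where "a = sum \<mu>X X" and "b = sum \<mu>Y Y"
    and "a1 = sum \<mu>X (X \<inter> A)" and "b1 = sum \<mu>Y (Y \<inter> B)"
  define a0 b0 a01 b01 where "a0 R = sum \<mu>X (X \<inter> fst R)" and "b0 R = sum \<mu>Y (Y \<inter> snd R)"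
    and "a01 R = sum \<mu>X (X \<inter> A \<inter> fst R)" and "b01 R = sum \<mu>Y (Y \<inter> B \<inter> snd R)"
    for R :: "bool list set \<times> bool list set"
  note defs = a_def b_def a1_def b1_def a0_def b0_def a01_def b01_def
  have sub: "X \<inter> S \<subseteq> cube n" "Y \<inter> S \<subseteq> cube n" for S using XY by auto
  have sub2: "X \<inter> A \<inter> S \<subseteq> cube n" "Y \<inter> B \<inter> S \<subseteq> cube n" for S using XY by auto
  have nn: "0 \<le> a0 R" "0 \<le> b0 R" "0 \<le> a01 R" "0 \<le> b01 R" "0 \<le> a1" "0 \<le> b1" for R
    unfolding defs by (simp_all add: sum_\<mu>X_nonneg sum_\<mu>Y_nonneg sub sub2)
  have ab: "0 < a" "0 < b"
    using pos sum_\<mu>X_nonneg[OF XY(1)] sum_\<mu>Y_nonneg[OF XY(2)]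
    by (auto simp: mass_def defs zero_less_mult_iff)
  have big': "\<kappa> * (a * b) \<le> a1 * b1" using big by (simp add: defs mass_def)
  then have "0 < a1 * b1" using ab \<kappa>_pos by (smt (verit) mult_pos_pos)
  then have a1b1: "0 < a1" "0 < b1" using nn(5,6) by (auto simp: zero_less_mult_iff)
  have le: "a1 \<le> a" "b1 \<le> b" unfolding defs by (simp_all add: XY sum_\<mu>X_Int_le sum_\<mu>Y_Int_le)
  have wF: "0 \<le> w False R" if "R \<in> F" for R using that F w_nonneg by blast
  have finF: "finite F" using F finite_rects finite_subset by blast
  have cov_le: "(\<Sum>R\<in>G. w False R * (a0 R * b0 R)) \<le> a * b" if "G \<subseteq> F" for G
    using integ_cov_le_mass[of X Y G] that F XY by (auto simp: integ_cov mass_def defs)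
  have small: "(\<Sum>R\<in>G. w False R * (a01 R * b01 R)) \<le> 6 * D * (a1 * b1)" if "G \<subseteq> F" for G
  proof -
    have "integ (cov G) (X \<inter> A) (Y \<inter> B) \<le> integ (cov (rects n)) (X \<inter> A) (Y \<inter> B)"
      using that F sub by (intro integ_cov_mono) auto
    also have "\<dots> \<le> 6 * D * mass (X \<inter> A) (Y \<inter> B)"
      using integ_cover_nearly_one_colored[OF sub mono] by (simp add: cov_rects[abs_def])
    finally show ?thesis using sub by (simp add: integ_cov mass_def defs)
  qed
  \<comment> \<open>\<open>G\<close> holds the exceptions, whose share does not drop by \<sigma>^2;
    in \<open>GA\<close> the share of the rows drops by \<sigma>, in \<open>GB\<close> that of the
    columns. The comparisons of shares are cross-multiplied.\<close>
  define G where "G = {R \<in> F. \<sigma>\<^sup>2 * (a0 R * b0 R) * (a1 * b1) < a01 R * b01 R * (a * b)}"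
  define GA where "GA = {R \<in> F. a01 R * a \<le> \<sigma> * a0 R * a1}"
  define GB where "GB = {R \<in> F. b01 R * b \<le> \<sigma> * b0 R * b1}"
  have GF: "G \<subseteq> F" "GA \<subseteq> F" "GB \<subseteq> F" by (auto simp: G_def GA_def GB_def)
  \<comment> \<open>Going back from the small rectangle to the large one multiplies the covered
    fraction of the exceptions by at most 1 / \<sigma>^2, so it is at most 6 * D / \<sigma>^2, hence
    at most \<eta>.\<close>
  have "(\<Sum>R\<in>G. w False R * (a0 R * b0 R)) * (\<sigma>\<^sup>2 * (a1 * b1))
      = (\<Sum>R\<in>G. w False R * (\<sigma>\<^sup>2 * (a0 R * b0 R) * (a1 * b1)))"
    by (simp add: sum_distrib_right sum_distrib_left ac_simps)
  also have "\<dots> \<le> (\<Sum>R\<in>G. w False R * (a01 R * b01 R * (a * b)))"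
    by (intro sum_mono mult_left_mono) (auto simp: G_def wF)
  also have "\<dots> = (\<Sum>R\<in>G. w False R * (a01 R * b01 R)) * (a * b)"
    by (simp add: sum_distrib_right sum_distrib_left ac_simps)
  also have "\<dots> \<le> 6 * D * (a1 * b1) * (a * b)"
    using small[OF GF(1)] ab by (intro mult_right_mono) auto
  also have "\<dots> \<le> \<eta> * \<sigma>\<^sup>2 * (a1 * b1) * (a * b)"
    using D_le ab nn(5,6) by (intro mult_right_mono) auto
  finally have "(\<Sum>R\<in>G. w False R * (a0 R * b0 R)) * (\<sigma>\<^sup>2 * (a1 * b1)) \<le> \<eta> * (a * b) * (\<sigma>\<^sup>2 * (a1 * b1))"
    by (simp add: ac_simps)
  moreover have "0 < \<sigma>\<^sup>2 * (a1 * b1)" using \<sigma>_pos a1b1 by simp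
  ultimately have "(\<Sum>R\<in>G. w False R * (a0 R * b0 R)) \<le> \<eta> * (a * b)"
    using mult_le_cancel_right_pos by blast
  then have "integ (cov G) X Y \<le> \<eta> * mass X Y"
    by (simp add: integ_cov XY mass_def defs)
  then have WG: "sum (w False) G < sum (w False) F / 4"
    using no_discard[OF GF(1)] by linarith
  have "F \<subseteq> G \<union> (GA \<union> GB)"
  proof
    fix R assume R: "R \<in> F"
    show "R \<in> G \<union> (GA \<union> GB)"
    proof (rule ccontr)
      assume "R \<notin> G \<union> (GA \<union> GB)"
      then have *: "a01 R * b01 R * (a * b) \<le> \<sigma>\<^sup>2 * (a0 R * b0 R) * (a1 * b1)"
        "\<sigma> * a0 R * a1 < a01 R * a" "\<sigma> * b0 R * b1 < b01 R * b"
        using R by (auto simp: G_def GA_def GB_def)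
      have "(\<sigma> * a0 R * a1) * (\<sigma> * b0 R * b1) < (a01 R * a) * (b01 R * b)"
        by (rule mult_strict_mono'[OF *(2,3)]) (use nn \<sigma>_pos in auto)
      then show False using *(1) by (simp add: power2_eq_square ac_simps)
    qed
  qed
  then have "sum (w False) F \<le> sum (w False) (G \<union> (GA \<union> GB))"
    using finF GF wF by (intro sum_mono2) (auto intro: finite_subset)
  also have "\<dots> \<le> sum (w False) G + (sum (w False) GA + sum (w False) GB)"
  proof -
    have un: "sum (w False) (S \<union> S') \<le> sum (w False) S + sum (w False) S'" if "S \<subseteq> F" "S' \<subseteq> F" for S S'
    proof -
      have "finite S" "finite S'" using that finF finite_subset by blast+
      moreover have "0 \<le> sum (w False) (S \<inter> S')" using that wF by (intro sum_nonneg) auto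
      ultimately show ?thesis using sum.union_inter[of S S' "w False"] by linarith
    qed
    show ?thesis using un[of G "GA \<union> GB"] un[of GA GB] GF by auto
  qed
  finally have tot: "sum (w False) F \<le> sum (w False) G + (sum (w False) GA + sum (w False) GB)" .
  have WF: "0 \<le> sum (w False) F" using wF by (intro sum_nonneg) auto
  \<comment> \<open>\<open>GA\<close> and \<open>GB\<close> together carry more than three quarters
    of the weight.\<close>
  consider "sum (w False) F / 4 \<le> sum (w False) GA" | "sum (w False) F / 4 \<le> sum (w False) GB"
    using tot WG WF by linarith
  then show ?thesis
  proof cases
    case 1
    \<comment> \<open>Restricting only the rows leaves the column factor \<open>b0\<close> alone.
      The total cover of the original rectangle is at most its mass, so the bound for each member of
      \<open>GA\<close> sums to \<sigma> times the restricted mass.\<close>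
    have "(\<Sum>R\<in>GA. w False R * (a01 R * b0 R)) * a = (\<Sum>R\<in>GA. w False R * (a01 R * a * b0 R))"
      by (simp add: sum_distrib_right sum_distrib_left ac_simps)
    also have "\<dots> \<le> (\<Sum>R\<in>GA. w False R * (\<sigma> * a0 R * a1 * b0 R))"
      by (intro sum_mono mult_left_mono mult_right_mono) (auto simp: GA_def wF nn)
    also have "\<dots> = \<sigma> * a1 * (\<Sum>R\<in>GA. w False R * (a0 R * b0 R))"
      by (simp add: sum_distrib_left ac_simps)
    also have "\<dots> \<le> \<sigma> * a1 * (a * b)"
      using cov_le[OF GF(2)] \<sigma>_pos nn by (intro mult_left_mono) auto
    finally have "(\<Sum>R\<in>GA. w False R * (a01 R * b0 R)) * a \<le> \<sigma> * (a1 * b) * a"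
      by (simp add: ac_simps)
    then have "(\<Sum>R\<in>GA. w False R * (a01 R * b0 R)) \<le> \<sigma> * (a1 * b)"
      using ab(1) mult_le_cancel_right_pos by blast
    then have "integ (cov GA) (X \<inter> A) Y \<le> \<sigma> * mass (X \<inter> A) Y"
      using sub XY by (simp add: integ_cov mass_def defs)
    moreover have "a1 * b1 \<le> a1 * b" using le nn by (intro mult_left_mono) auto
    then have "\<kappa> * mass X Y \<le> mass (X \<inter> A) Y"
      using big' by (simp add: mass_def defs)
    ultimately show ?thesis using 1 GF by blast
  next
    case 2
    have "(\<Sum>R\<in>GB. w False R * (a0 R * b01 R)) * b = (\<Sum>R\<in>GB. w False R * (b01 R * b * a0 R))"
      by (simp add: sum_distrib_right sum_distrib_left ac_simps)
    also have "\<dots> \<le> (\<Sum>R\<in>GB. w False R * (\<sigma> * b0 R * b1 * a0 R))"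
      by (intro sum_mono mult_left_mono mult_right_mono) (auto simp: GB_def wF nn)
    also have "\<dots> = \<sigma> * b1 * (\<Sum>R\<in>GB. w False R * (a0 R * b0 R))"
      by (simp add: sum_distrib_left ac_simps)
    also have "\<dots> \<le> \<sigma> * b1 * (a * b)"
      using cov_le[OF GF(3)] \<sigma>_pos nn by (intro mult_left_mono) auto
    finally have "(\<Sum>R\<in>GB. w False R * (a0 R * b01 R)) * b \<le> \<sigma> * (a * b1) * b"
      by (simp add: ac_simps)
    then have "(\<Sum>R\<in>GB. w False R * (a0 R * b01 R)) \<le> \<sigma> * (a * b1)"
      using ab(2) mult_le_cancel_right_pos by blast
    then have "integ (cov GB) X (Y \<inter> B) \<le> \<sigma> * mass X (Y \<inter> B)"
      using sub XY by (simp add: integ_cov mass_def defs)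
    moreover have "a1 * b1 \<le> a * b1" using le nn by (intro mult_right_mono) auto
    then have "\<kappa> * mass X Y \<le> mass X (Y \<inter> B)"
      using big' by (simp add: mass_def defs)
    ultimately show ?thesis using 2 GF by blast
  qed
qed

text \<open>
  Every summand is additive in the rectangle up to the losses charged to the budget of s
  weight-reducing steps; t bounds the number of consecutive misses. A node may stop with the majority
  answer, at an excess error of at most 1/50 of its mass, as soon as bad exceeds that mass.
\<close>
definition bad :: "(bool list set \<times> bool list set) set \<Rightarrow> nat \<Rightarrow> nat \<Rightarrow> bool list set \<Rightarrow> bool list set \<Rightarrow> real" where
  "bad F s t X Y = 5 * loss False X Y + 5 * loss True X Y + 5 * integ (cov (rects n - F)) X Y
     + \<gamma> * s * mass X Y + (1 - \<kappa>) ^ t * mass X Y"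

section \<open>The error budget and the recursion\<close>

lemma \<gamma>_nonneg: "0 \<le> \<gamma>"
  using T_large \<sigma>_pos \<kappa>_le_1 by (smt (verit) zero_le_power)

lemma bad_ge:
  assumes "X \<subseteq> cube n" "Y \<subseteq> cube n" "F \<subseteq> rects n"
  shows "5 * loss z X Y \<le> bad F s t X Y" "5 * integ (cov (rects n - F)) X Y \<le> bad F s t X Y"
    "mass X Y \<le> bad F s 0 X Y" "0 \<le> bad F s t X Y"
proof -
  have "0 \<le> loss False X Y" "0 \<le> loss True X Y" "0 \<le> integ (cov (rects n - F)) X Y"
    "0 \<le> \<gamma> * s * mass X Y" "0 \<le> (1 - \<kappa>) ^ t * mass X Y"
    using assms \<gamma>_nonneg \<kappa>_le_1 by (auto simp: loss_nonneg mass_nonneg intro!: integ_cov_nonneg)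
  then show "5 * loss z X Y \<le> bad F s t X Y" "5 * integ (cov (rects n - F)) X Y \<le> bad F s t X Y"
    "mass X Y \<le> bad F s 0 X Y" "0 \<le> bad F s t X Y"
    unfolding bad_def by (cases z; simp)+
qed

text \<open>A single leaf suffices. The minority colour has at most half of the mass, and 1/2 =
  12/25 + 1/50, so \<open>bad\<close> pays the excess once it reaches the mass.\<close>

lemma stopping_output:
  assumes "X \<subseteq> cube n" "Y \<subseteq> cube n" "F \<subseteq> rects n"
    and "mass X Y \<le> bad F s t X Y \<or> color z X Y \<le> 12 / 25 * mass X Y"
  shows "\<exists>P. leaves P \<le> (t + 1) * (T + 1) ^ s \<and> err P X Y \<le> 12 / 25 * mass X Y + bad F s t X Y / 50"
proof -
  have "\<exists>b. color b X Y \<le> 12 / 25 * mass X Y + bad F s t X Y / 50"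
  proof (cases "mass X Y \<le> bad F s t X Y")
    case True
    then have "color False X Y \<le> 12 / 25 * mass X Y + bad F s t X Y / 50 \<or>
        color True X Y \<le> 12 / 25 * mass X Y + bad F s t X Y / 50"
      using color_add[of X Y] by linarith
    then show ?thesis by blast
  next
    case False
    then have "color z X Y \<le> 12 / 25 * mass X Y + bad F s t X Y / 50"
      using assms(4) bad_ge(4)[OF assms(1-3), of s t] by linarith
    then show ?thesis by blast
  qed
  then obtain b where "err (Out (\<not> b)) X Y \<le> 12 / 25 * mass X Y + bad F s t X Y / 50"
    by (auto simp: err_Out)
  moreover have "leaves (Out (\<not> b)) \<le> (t + 1) * (T + 1) ^ s"
    by (simp add: Suc_le_eq)
  ultimately show ?thesis by blast
qed

text \<open>If \<open>bad\<close> is below the mass, the uncovered zeros and the dead cover are each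
  below 1/5 of it. The live cover adds at most 1/20, and 1/5 + 1/5 + 1/20 < 12/25.\<close>

lemma light_cover_stops:
  assumes XY: "X \<subseteq> cube n" "Y \<subseteq> cube n" and F: "F \<subseteq> rects n"
    and light: "sum (w False) F \<le> 1 / 20"
  shows "mass X Y \<le> bad F s t X Y \<or> color False X Y \<le> 12 / 25 * mass X Y"
proof (rule ccontr)
  assume "\<not> ?thesis"
  then have *: "bad F s t X Y < mass X Y" "12 / 25 * mass X Y < color False X Y" by auto
  have "integ (\<lambda>p. of_bool (f p = False) * cover n (w False) p) X Y \<le> integ (cover n (w False)) X Y"
    by (intro integ_mono XY) (auto simp: cover_def intro!: sum_nonneg w_nonneg)
  also have "\<dots> = integ (cov (rects n - F)) X Y + integ (cov F) X Y"
    by (rule integ_cov_compl[OF XY F])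
  finally have "color False X Y \<le> loss False X Y + integ (cov (rects n - F)) X Y + integ (cov F) X Y"
    using color_eq_loss_plus[of False X Y] by linarith
  moreover have "integ (cov F) X Y \<le> sum (w False) F * mass X Y"
    unfolding integ_cov[OF XY] sum_distrib_right
  proof (rule sum_mono)
    fix R assume "R \<in> F"
    then have "0 \<le> w False R" using F w_nonneg by blast
    moreover have "mass (X \<inter> fst R) (Y \<inter> snd R) \<le> mass X Y"
      unfolding mass_def
      by (rule mult_mono) (use XY in \<open>auto intro!: sum_\<mu>X_Int_le sum_\<mu>Y_Int_le sum_\<mu>X_nonneg sum_\<mu>Y_nonneg\<close>)
    ultimately show "w False R * mass (X \<inter> fst R) (Y \<inter> snd R) \<le> w False R * mass X Y"
      by (rule mult_left_mono[rotated])
  qed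
  moreover have "sum (w False) F * mass X Y \<le> 1 / 20 * mass X Y"
    using light mass_nonneg[OF XY] by (rule mult_right_mono)
  ultimately show False
    using * bad_ge(1)[OF XY F, of False s t] bad_ge(2)[OF XY F, of s t] mass_nonneg[OF XY] by linarith
qed

text \<open>The budget of one cut, with \<open>M1\<close> the hit, \<open>M2\<close> the miss,
  \<open>d\<close> the dead cover and \<open>k1\<close> the cover that dies on the hit. One unit
  \<gamma> on \<open>M1\<close> pays for 5 * \<open>k1\<close> and for resetting the miss count to
  \<open>T\<close>. On the miss side \<open>M2\<close> is at most 1 - \<kappa> times
  \<open>M\<close>, which absorbs the decrease of the exponent.\<close>

lemma bad_children:
  assumes cut: "\<kappa> * M \<le> M1" "M = M1 + M2" and M1: "0 \<le> M1"
    and dead: "d1 + d2 = d" "k1 \<le> \<sigma> * M1"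
  shows "5 * (d1 + k1) + \<gamma> * real s * M1 + (1 - \<kappa>) ^ T * M1
       + (5 * d2 + \<gamma> * real (Suc s) * M2 + (1 - \<kappa>) ^ t * M2)
     \<le> 5 * d + \<gamma> * real (Suc s) * M + (1 - \<kappa>) ^ Suc t * M"
proof -
  have "(5 * \<sigma> + (1 - \<kappa>) ^ T) * M1 \<le> \<gamma> * M1"
    using T_large M1 by (intro mult_right_mono)
  moreover have "(1 - \<kappa>) ^ t * M2 \<le> (1 - \<kappa>) ^ t * ((1 - \<kappa>) * M)"
    using cut \<kappa>_le_1 by (intro mult_left_mono) (auto simp: algebra_simps)
  ultimately show ?thesis using dead cut(2) by (simp add: algebra_simps)
qed

text \<open>The outer induction counts weight-reducing steps, the inner one misses. From (s+1, t+1),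
  a hit leads to (s, T), a miss to (s+1, t), and a discard, which sends nothing, to (s, t+1). The
  leaf bound solves this recurrence: a hit child has at most (T+1)^(s+1) leaves, one such summand
  per unit of \<open>t\<close>.\<close>

lemma recursive_protocol:
  assumes "X \<subseteq> cube n" "Y \<subseteq> cube n" "F \<subseteq> rects n" "sum (w False) F * (3 / 4) ^ s \<le> 1 / 20"
  shows "\<exists>P. leaves P \<le> (t + 1) * (T + 1) ^ s \<and> err P X Y \<le> 12 / 25 * mass X Y + bad F s t X Y / 50"
  using assms
proof (induction s arbitrary: F X Y t)
  case 0
  then show ?case
    using stopping_output[OF 0(1-3), of 0 t False] light_cover_stops[OF 0(1-3), of 0 t] by simp
next
  case (Suc s)
  note IHs = Suc.IH
  have shrink: "sum (w False) (F - G) * (3 / 4) ^ s \<le> 1 / 20"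
    if "G \<subseteq> F" "sum (w False) F / 4 \<le> sum (w False) G" for G
  proof -
    have "finite F" using Suc.prems finite_rects finite_subset by blast
    then have "sum (w False) (F - G) \<le> sum (w False) F * (3 / 4)"
      using that by (simp add: sum_diff finite_subset)
    then have "sum (w False) (F - G) * (3 / 4) ^ s \<le> sum (w False) F * (3 / 4) * (3 / 4) ^ s"
      by (intro mult_right_mono) auto
    also have "\<dots> = sum (w False) F * (3 / 4) ^ Suc s" by simp
    finally show ?thesis using Suc.prems(4) by linarith
  qed
  \<comment> \<open>A miss keeps \<open>F\<close>, so only the rectangle varies in the inner
    induction.\<close>
  from Suc.prems(1-3) show ?case
  proof (induction t arbitrary: X Y)
    case 0
    then show ?case
      by (intro stopping_output[of _ _ _ _ _ True] disjI1 bad_ge(3))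
  next
    case (Suc t)
    note XY = Suc.prems(1,2) and F = Suc.prems(3)
    show ?case
    proof (cases "mass X Y \<le> bad F (Suc s) (Suc t) X Y \<or> color True X Y \<le> 12 / 25 * mass X Y")
      case True
      then show ?thesis by (rule stopping_output[OF XY F])
    next
      case False
      then have pos: "0 < mass X Y" and col: "12 / 25 * mass X Y < color True X Y"
        and ls: "5 * loss True X Y < mass X Y"
        using bad_ge(1)[OF XY F, of True "Suc s" "Suc t"] bad_ge(4)[OF XY F, of "Suc s" "Suc t"] by linarith+
      have T1: "(T + 1) * (T + 1) ^ s + (t + 1) * (T + 1) ^ Suc s = (Suc t + 1) * (T + 1) ^ Suc s"
        by (simp add: algebra_simps)
      show ?thesis
      proof (cases "\<exists>G\<subseteq>F. sum (w False) F / 4 \<le> sum (w False) G \<and> integ (cov G) X Y \<le> \<eta> * mass X Y")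
        case True
        then obtain G where G: "G \<subseteq> F" "sum (w False) F / 4 \<le> sum (w False) G"
          "integ (cov G) X Y \<le> \<eta> * mass X Y" by blast
        have FG: "F - G \<subseteq> rects n" using F by auto
        obtain P where P: "leaves P \<le> (Suc t + 1) * (T + 1) ^ s"
          "err P X Y \<le> 12 / 25 * mass X Y + bad (F - G) s (Suc t) X Y / 50"
          using IHs[OF XY FG shrink[OF G(1,2)]] by blast
        \<comment> \<open>One unit of the step budget pays for the newly dead cover.\<close>
        have "5 * \<eta> * mass X Y \<le> \<gamma> * mass X Y"
          using \<eta>_le pos by (intro mult_right_mono) auto
        then have "bad (F - G) s (Suc t) X Y \<le> bad F (Suc s) (Suc t) X Y"
          using G(3) unfolding bad_def integ_cov_Un[OF XY G(1) F] by (simp add: algebra_simps)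
        moreover have "(Suc t + 1) * (T + 1) ^ s \<le> (Suc t + 1) * (T + 1) ^ Suc s"
          by (intro mult_le_mono2 power_increasing) auto
        ultimately have "leaves P \<le> (Suc t + 1) * (T + 1) ^ Suc s \<and>
            err P X Y \<le> 12 / 25 * mass X Y + bad F (Suc s) (Suc t) X Y / 50"
          using P by linarith
        then show ?thesis by blast
      next
        case False
        then have "\<eta> * mass X Y < integ (cov G) X Y"
          if "G \<subseteq> F" "sum (w False) F / 4 \<le> sum (w False) G" for G
          using that by (meson not_le)
        from exists_progress[OF XY F pos col ls this]
        consider A G where "G \<subseteq> F" "sum (w False) F / 4 \<le> sum (w False) G"
            "\<kappa> * mass X Y \<le> mass (X \<inter> A) Y" "integ (cov G) (X \<inter> A) Y \<le> \<sigma> * mass (X \<inter> A) Y"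
          | B G where "G \<subseteq> F" "sum (w False) F / 4 \<le> sum (w False) G"
            "\<kappa> * mass X Y \<le> mass X (Y \<inter> B)" "integ (cov G) X (Y \<inter> B) \<le> \<sigma> * mass X (Y \<inter> B)"
          by blast
        then show ?thesis
        proof cases
          case (1 A G)
          have sub: "X \<inter> A \<subseteq> cube n" "X - A \<subseteq> cube n" "F - G \<subseteq> rects n" using XY F by auto
          obtain P1 where P1: "leaves P1 \<le> (T + 1) * (T + 1) ^ s"
            "err P1 (X \<inter> A) Y \<le> 12 / 25 * mass (X \<inter> A) Y + bad (F - G) s T (X \<inter> A) Y / 50"
            using IHs[OF sub(1) XY(2) sub(3) shrink[OF 1(1,2)]] by blast
          obtain P0 where P0: "leaves P0 \<le> (t + 1) * (T + 1) ^ Suc s"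
            "err P0 (X - A) Y \<le> 12 / 25 * mass (X - A) Y + bad F (Suc s) t (X - A) Y / 50"
            using Suc.IH[OF sub(2) XY(2) F] by blast
          have "loss z X Y = loss z (X \<inter> A) Y + loss z (X - A) Y" for z
            unfolding loss_def by (rule integ_split_left[OF XY])
          from this[of False] this[of True]
          have "bad (F - G) s T (X \<inter> A) Y + bad F (Suc s) t (X - A) Y \<le> bad F (Suc s) (Suc t) X Y"
            using bad_children[OF 1(3) mass_split_left[OF XY] mass_nonneg[OF sub(1) XY(2)]
                integ_split_left[OF XY, where g = "cov (rects n - F)" and A = A, symmetric] 1(4), where s = s and t = t]
            unfolding bad_def integ_cov_Un[OF sub(1) XY(2) 1(1) F] by linarith
          then have "err (Alice (\<lambda>x. x \<in> A) P0 P1) X Y \<le> 12 / 25 * mass X Y + bad F (Suc s) (Suc t) X Y / 50"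
            using P0(2) P1(2) mass_split_left[OF XY, of A] unfolding err_Alice[OF XY] by linarith
          moreover have "leaves (Alice (\<lambda>x. x \<in> A) P0 P1) \<le> (Suc t + 1) * (T + 1) ^ Suc s"
            unfolding leaves.simps using P0(1) P1(1) T1 by linarith
          ultimately show ?thesis by blast
        next
          case (2 B G)
          have sub: "Y \<inter> B \<subseteq> cube n" "Y - B \<subseteq> cube n" "F - G \<subseteq> rects n" using XY F by auto
          obtain P1 where P1: "leaves P1 \<le> (T + 1) * (T + 1) ^ s"
            "err P1 X (Y \<inter> B) \<le> 12 / 25 * mass X (Y \<inter> B) + bad (F - G) s T X (Y \<inter> B) / 50"
            using IHs[OF XY(1) sub(1) sub(3) shrink[OF 2(1,2)]] by blast
          obtain P0 where P0: "leaves P0 \<le> (t + 1) * (T + 1) ^ Suc s"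
            "err P0 X (Y - B) \<le> 12 / 25 * mass X (Y - B) + bad F (Suc s) t X (Y - B) / 50"
            using Suc.IH[OF XY(1) sub(2) F] by blast
          have "loss z X Y = loss z X (Y \<inter> B) + loss z X (Y - B)" for z
            unfolding loss_def by (rule integ_split_right[OF XY])
          from this[of False] this[of True]
          have "bad (F - G) s T X (Y \<inter> B) + bad F (Suc s) t X (Y - B) \<le> bad F (Suc s) (Suc t) X Y"
            using bad_children[OF 2(3) mass_split_right[OF XY] mass_nonneg[OF XY(1) sub(1)]
                integ_split_right[OF XY, where g = "cov (rects n - F)" and B = B, symmetric] 2(4), where s = s and t = t]
            unfolding bad_def integ_cov_Un[OF XY(1) sub(1) 2(1) F] by linarith
          then have "err (Bob (\<lambda>y. y \<in> B) P0 P1) X Y \<le> 12 / 25 * mass X Y + bad F (Suc s) (Suc t) X Y / 50"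
            using P0(2) P1(2) mass_split_right[OF XY, of B] unfolding err_Bob[OF XY] by linarith
          moreover have "leaves (Bob (\<lambda>y. y \<in> B) P0 P1) \<le> (Suc t + 1) * (T + 1) ^ Suc s"
            unfolding leaves.simps using P0(1) P1(1) T1 by linarith
          ultimately show ?thesis by blast
        qed
      qed
    qed
  qed
qed

end

section \<open>From the linear program to the protocol\<close>

text \<open>The number of misses, about 8^k, over the weight bound (8/7)^k is about 7^k; this makes
  \<open>T\<close> times \<kappa> reach 20 * (k+1).\<close>

lemma seven_power_ge: "20 \<le> k \<Longrightarrow> 400 * (k + 1) + 1 \<le> (7::nat) ^ k"
  by (induction k rule: nat_induct_at_least) auto

text \<open>Bernoulli bounds (1+x)^m from below, and (1-x) * (1+x) is at most 1.\<close>

lemma one_minus_power_le: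
  fixes x :: real
  assumes "0 \<le> x" "x \<le> 1" "0 < c" "c \<le> real m * x"
  shows "(1 - x) ^ m \<le> 1 / c"
proof -
  have "c \<le> (1 + x) ^ m" using Bernoulli_inequality[of x m] assms by simp
  then have "(1 - x) ^ m * c \<le> (1 - x) ^ m * (1 + x) ^ m"
    using assms by (intro mult_left_mono) auto
  also have "\<dots> = (1 - x\<^sup>2) ^ m"
    by (simp add: power2_eq_square algebra_simps flip: power_mult_distrib)
  also have "\<dots> \<le> 1"
    using assms by (intro power_le_one) (auto simp: power2_eq_square mult_le_one)
  finally show ?thesis using assms by (simp add: field_simps)
qed

section \<open>Feasible solutions of the linear programs\<close>

lemma mu_z_nonneg: "is_distribution n \<mu> \<Longrightarrow> 0 \<le> mu_z n \<mu> f z"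
  by (auto simp: mu_z_def is_distribution_def intro!: sum_nonneg)

text \<open>This replaces a given \<delta>, possibly 0, by the positive value of \<open>D\<close>
  for which the parameters are tuned.\<close>

lemma srec_feasible_mono:
  assumes "srec_feasible n f \<mu> z \<delta> \<delta> w" "\<delta> \<le> \<delta>'" "is_distribution n \<mu>"
  shows "srec_feasible n f \<mu> z \<delta>' \<delta>' w"
proof -
  have "(1 - \<delta>') * mu_z n \<mu> f z \<le> (1 - \<delta>) * mu_z n \<mu> f z"
    using assms mu_z_nonneg by (intro mult_right_mono) auto
  then show ?thesis using assms(1,2) unfolding srec_feasible_def by force
qed

text \<open>Weight 1 on each single point of colour \<open>z\<close>. Without a feasible point the
  infimum would carry no information.\<close>

lemma ex_srec_feasible:
  assumes "0 \<le> \<delta>" "is_distribution n \<mu>"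
  shows "\<exists>w. srec_feasible n f \<mu> z \<delta> \<delta> w"
proof -
  define w :: "bool list set \<times> bool list set \<Rightarrow> real"
    where "w R = of_bool (\<exists>p\<in>dom2 n. f p = z \<and> R = ({fst p}, {snd p}))" for R
  have cov: "cover n w p = of_bool (f p = z)" if p: "p \<in> dom2 n" for p
  proof -
    have "cover n w p = (\<Sum>R\<in>{({fst p}, {snd p})}. w R)"
      unfolding cover_def
    proof (rule sum.mono_neutral_right)
      show "finite {R \<in> rects n. inrect p R}" using finite_rects by simp
    qed (use p in \<open>auto simp: rects_def inrect_def dom2_def w_def\<close>)
    also have "\<dots> = of_bool (f p = z)"
      using p by (auto simp: w_def prod_eq_iff intro!: bexI[of _ p])
    finally show ?thesis .
  qed
  have "(\<Sum>p\<in>{p\<in>dom2 n. f p = z}. \<mu> p * cover n w p) = mu_z n \<mu> f z"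
    unfolding mu_z_def by (rule sum.cong) (auto simp: cov)
  moreover have "(1 - \<delta>) * mu_z n \<mu> f z \<le> mu_z n \<mu> f z"
    using assms mu_z_nonneg[OF assms(2), of f z] by (simp add: algebra_simps)
  ultimately have "srec_feasible n f \<mu> z \<delta> \<delta> w"
    unfolding srec_feasible_def using assms by (auto simp: cov w_def)
  then show ?thesis by blast
qed

lemma small_srec_imp_cover:
  fixes k :: nat
  assumes "0 \<le> \<delta>" "is_distribution n \<mu>" "0 < k"
    and "\<lceil>100 * log 2 (srec n f \<mu> \<delta> \<delta>)\<rceil> \<le> int k"
  shows "\<exists>w. srec_feasible n f \<mu> z \<delta> \<delta> w \<and> sum w (rects n) \<le> (8 / 7) ^ k"
proof -
  let ?S = "srec n f \<mu> \<delta> \<delta>"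
  \<comment> \<open>The strict gap between 2^(1/100) and 8/7 yields a feasible solution below
    (8/7)^k without showing that the optimum is attained.\<close>
  have root: "2 powr (1 / 100) < (8 / 7 :: real)"
  proof (rule ccontr)
    assume "\<not> ?thesis"
    then have "(8 / 7 :: real) ^ 100 \<le> (2 powr (1 / 100)) ^ 100" by (intro power_mono) auto
    then have "(8 / 7 :: real) ^ 100 \<le> 2" by (simp add: powr_power)
    moreover have "(8 / 7 :: real) ^ 6 \<le> (8 / 7) ^ 100" by (intro power_increasing) auto
    moreover have "2 < (8 / 7 :: real) ^ 6" by (simp add: power_divide)
    ultimately show False by linarith
  qed
  have "?S < (8 / 7) ^ k"
  proof (cases "0 < ?S")
    case True
    have "100 * log 2 ?S \<le> real k" using assms(4) by (simp add: ceiling_le_iff)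
    then have "?S \<le> 2 powr (real k / 100)" using True log_le_iff[of 2 "srec n f \<mu> \<delta> \<delta>" "real k / 100"] by simp
    also have "\<dots> = (2 powr (1 / 100)) ^ k" by (simp add: powr_power)
    also have "\<dots> < (8 / 7) ^ k" using root assms(3) by (intro power_strict_mono) auto
    finally show ?thesis .
  next
    \<comment> \<open>The logarithm gives no information at a nonpositive value, but there the bound
      is immediate.\<close>
    case False
    moreover have "(0::real) < (8 / 7) ^ k" by simp
    ultimately show ?thesis by linarith
  qed
  moreover have "srec_z n f \<mu> z \<delta> \<delta> \<le> ?S" unfolding srec_def by (cases z) auto
  ultimately have "Inf {sum w (rects n) | w. srec_feasible n f \<mu> z \<delta> \<delta> w} < (8 / 7) ^ k"
    unfolding srec_z_def by linarith
  from cInf_lessD[OF _ this] obtain w where "srec_feasible n f \<mu> z \<delta> \<delta> w" "sum w (rects n) < (8 / 7) ^ k"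
    using ex_srec_feasible[OF assms(1,2), of f z] by auto
  then show ?thesis by (intro exI[of _ w]) simp
qed

section \<open>Choice of parameters and the two bounds\<close>

lemma CC_le_of_covers:
  fixes k :: nat
  assumes \<mu>: "is_product_distribution n \<mu>" and k: "20 \<le> k"
    and D: "D = 1 / (3000 * (real k + 1) ^ 4)"
    and feas: "\<And>z. srec_feasible n f \<mu> z D D (w z)"
    and wsum: "\<And>z. sum (w z) (rects n) \<le> (8 / 7) ^ k"
  shows "CC n f \<mu> 0.49 \<le> 4 * (3 * (k * (k + 1)))"
proof -
  obtain \<mu>X \<mu>Y where X: "\<forall>x\<in>cube n. 0 \<le> \<mu>X x" "(\<Sum>x\<in>cube n. \<mu>X x) = 1"
    and Y: "\<forall>y\<in>cube n. 0 \<le> \<mu>Y y" "(\<Sum>y\<in>cube n. \<mu>Y y) = 1"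
    and prod: "\<forall>x\<in>cube n. \<forall>y\<in>cube n. \<mu> (x, y) = \<mu>X x * \<mu>Y y"
    using \<mu> unfolding is_product_distribution_def by blast
  define K where "K = real k + 1"
  have K: "21 \<le> K" using k by (simp add: K_def)
  \<comment> \<open>The bases 8/7 and 8 fit together: 8^k / \<open>V\<close> = 7^k beats the misses,
    (8/7) * (3/4) = 6/7 lets \<open>k\<close> steps make the cover light, and \<open>T\<close> + 1 =
    8^k makes the leaf bound a power of two.\<close>
  define V :: real where "V = (8 / 7) ^ k"
  define \<kappa> where "\<kappa> = 1 / (20 * V)"
  define T :: nat where "T = 8 ^ k - 1"
  have V1: "1 \<le> V" unfolding V_def by (simp add: one_le_power)
  have T1: "T + 1 = 8 ^ k" unfolding T_def by simp
  have \<kappa>: "0 < \<kappa>" "\<kappa> \<le> 1" using V1 by (auto simp: \<kappa>_def)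
  have decay: "(1 - \<kappa>) ^ T \<le> 1 / (20 * K)"
  proof (rule one_minus_power_le)
    have "real (400 * (k + 1) + 1) \<le> real (7 ^ k)"
      using seven_power_ge[OF k] of_nat_mono by blast
    then have "400 * K \<le> 7 ^ k - 1" by (simp add: K_def)
    then have "V * (400 * K) \<le> V * (7 ^ k - 1)" using V1 by (intro mult_left_mono) auto
    also have "\<dots> = 8 ^ k - V" by (simp add: V_def algebra_simps flip: power_mult_distrib)
    also have "\<dots> \<le> real (T + 1) - 1" unfolding T1 using V1 by simp
    finally have "V * (400 * K) \<le> real T" by simp
    then show "20 * K \<le> real T * \<kappa>" using V1 by (simp add: \<kappa>_def field_simps)
  qed (use K \<kappa> in auto)
  \<comment> \<open>These values make 6 * D equal to \<eta> * \<sigma>^2, and 5 * \<sigma> plus the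
    bound of \<open>decay\<close> equal to \<gamma>. All \<open>k\<close> steps together cost at
    most 3/10.\<close>
  interpret smooth_cover n \<mu>X \<mu>Y f w D V \<kappa> "1 / (20 * K)" "4 / (5 * K\<^sup>2)" "3 / (10 * K)" T
  proof
    show "6 * D \<le> 4 / (5 * K\<^sup>2) * (1 / (20 * K))\<^sup>2"
      using K by (simp add: D K_def[symmetric] power2_eq_square power4_eq_xxxx)
    show "5 * (4 / (5 * K\<^sup>2)) \<le> 3 / (10 * K)"
      using K by (simp add: power2_eq_square field_simps)
    show "5 * (1 / (20 * K)) + (1 - \<kappa>) ^ T \<le> 3 / (10 * K)"
      using decay K by (simp add: field_simps)
  qed (use X Y feas wsum V1 K \<kappa> in \<open>auto simp: srec_feasible_def V_def[symmetric] \<kappa>_def D\<close>)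
  have sum_integ: "(\<Sum>p\<in>{p\<in>dom2 n. Q p}. \<mu> p * g p) = integ (\<lambda>p. of_bool (Q p) * g p) (cube n) (cube n)"
    for Q and g :: "bool list \<times> bool list \<Rightarrow> real"
    unfolding integ_def
    by (rule sum.mono_neutral_cong_left) (auto simp: dom2_def finite_cube prod)
  have mass1: "mass (cube n) (cube n) = 1" by (simp add: mass_def X Y)
  have mu: "mu_z n \<mu> f z = color z (cube n) (cube n)" for z
    using sum_integ[where Q = "\<lambda>p. f p = z" and g = "\<lambda>_. 1"] by (simp add: mu_z_def color_def)
  have loss: "loss z (cube n) (cube n) \<le> D * color z (cube n) (cube n)" for z
    using feas[of z] color_eq_loss_plus[of z "cube n" "cube n"]
    unfolding srec_feasible_def sum_integ mu by (simp add: algebra_simps)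
  have "D * color False (cube n) (cube n) + D * color True (cube n) (cube n) = D"
    using color_add[of "cube n" "cube n"] mass1 by (simp flip: distrib_left)
  then have "5 * loss False (cube n) (cube n) + 5 * loss True (cube n) (cube n) \<le> 5 * D"
    using loss[of False] loss[of True] by linarith
  moreover have "5 * D \<le> 1 / 100"
  proof -
    have "1 \<le> K ^ 4" using K by (simp add: one_le_power)
    then show ?thesis unfolding D K_def[symmetric] by (simp add: divide_le_eq)
  qed
  moreover have "3 / (10 * K) * real k \<le> 3 / 10" using K by (simp add: K_def field_simps)
  moreover have "1 / (20 * K) \<le> 1 / 20" using K by (simp add: field_simps)
  moreover have "integ (cov (rects n - rects n)) (cube n) (cube n) = 0"
    by (simp add: integ_cov)
  \<comment> \<open>The losses give 1/100, the steps 3/10 and the misses 1/20; no rectangle is dead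
    yet. The final error is then at most 12/25 + 1/100 = 0.49.\<close>
  ultimately have bad: "bad (rects n) k T (cube n) (cube n) \<le> 1 / 2"
    using decay unfolding bad_def mass1 by linarith
  have "sum (w False) (rects n) * (3 / 4) ^ k \<le> (8 / 7) ^ k * (3 / 4) ^ k"
    using wsum by (intro mult_right_mono) auto
  also have "\<dots> = (6 / 7) ^ k" by (simp flip: power_mult_distrib)
  also have "\<dots> \<le> (6 / 7) ^ 20" using k by (intro power_decreasing) auto
  also have "\<dots> \<le> (1 / 20 :: real)" by (simp add: power_divide)
  finally have light: "sum (w False) (rects n) * (3 / 4) ^ k \<le> 1 / 20" .
  obtain P where P: "leaves P \<le> (T + 1) * (T + 1) ^ k"
    "err P (cube n) (cube n) \<le> 12 / 25 * mass (cube n) (cube n) + bad (rects n) k T (cube n) (cube n) / 50"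
    using recursive_protocol[OF subset_refl subset_refl subset_refl light, of T] by blast
  have "proto_error n f \<mu> P = err P (cube n) (cube n)"
    using sum_integ[where Q = "\<lambda>p. run P (fst p) (snd p) \<noteq> f p" and g = "\<lambda>_. 1"] by (simp add: proto_error_def err_def)
  then have err: "proto_error n f \<mu> P \<le> 0.49" using P(2) bad unfolding mass1 by simp
  have "(T + 1) * (T + 1) ^ k = 2 ^ (3 * (k * (k + 1)))"
  proof -
    have "(T + 1) * (T + 1) ^ k = (8 ^ k) ^ (k + 1)" unfolding T1 by simp
    also have "\<dots> = 8 ^ (k * (k + 1))" by (rule power_mult[symmetric])
    also have "\<dots> = 2 ^ (3 * (k * (k + 1)))" unfolding power_mult[of 2 3] by simp
    finally show ?thesis .
  qed
  with P(1) have "leaves P \<le> 2 ^ (3 * (k * (k + 1)))" by (simp only:)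
  from CC_le_leaves[OF err this] show ?thesis .
qed

lemma CC_le_square:
  fixes k :: nat
  assumes \<mu>: "is_product_distribution n \<mu>" and k: "20 \<le> k"
    and \<delta>: "0 \<le> \<delta>" "\<delta> \<le> 1 / (3000 * (real k + 1) ^ 4)"
    and srec: "\<lceil>100 * log 2 (srec n f \<mu> \<delta> \<delta>)\<rceil> \<le> int k"
  shows "real (CC n f \<mu> 0.49) \<le> 24 * (real k)\<^sup>2"
proof -
  have dist: "is_distribution n \<mu>" using \<mu> by (simp add: is_product_distribution_def)
  have "\<exists>w. srec_feasible n f \<mu> z \<delta> \<delta> w \<and> sum w (rects n) \<le> (8 / 7) ^ k" for z
    using small_srec_imp_cover[OF \<delta>(1) dist _ srec] k by simp
  then obtain w where "\<And>z. srec_feasible n f \<mu> z \<delta> \<delta> (w z)" "\<And>z. sum (w z) (rects n) \<le> (8 / 7) ^ k"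
    by metis
  then have "CC n f \<mu> 0.49 \<le> 4 * (3 * (k * (k + 1)))"
    by (intro CC_le_of_covers[OF \<mu> k refl srec_feasible_mono[OF _ \<delta>(2) dist]]) auto
  also have "\<dots> \<le> 24 * k\<^sup>2" using k by (simp add: power2_eq_square)
  finally have "real (CC n f \<mu> 0.49) \<le> real (24 * k\<^sup>2)" by (rule of_nat_mono)
  then show ?thesis by simp
qed

text \<open>Either 1/n^2 is small enough for \<open>CC_le_square\<close>, or \<open>n\<close> is
  O(k^2) and sending all of \<open>x\<close> is cheap. Since log n is at least 1, that factor can be
  inserted at the end.\<close>

lemma CC_le_log_srec:
  assumes \<mu>: "is_product_distribution n \<mu>" and n: "2 \<le> n"
  shows "real (CC n f \<mu> 0.49)
    \<le> 2000000 * ((log 2 (srec n f \<mu> (1 / real n ^ 2) (1 / real n ^ 2)))\<^sup>2 * log 2 (real n) + 1)"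
proof -
  define L where "L = log 2 (srec n f \<mu> (1 / real n ^ 2) (1 / real n ^ 2))"
  define k where "k = max 20 (nat \<lceil>100 * L\<rceil>)"
  have k20: "20 \<le> k" and "\<lceil>100 * L\<rceil> \<le> int k" by (auto simp: k_def)
  have CC: "real (CC n f \<mu> 0.49) \<le> 62 * (real k)\<^sup>2"
  proof (cases "1 / real n ^ 2 \<le> 1 / (3000 * (real k + 1) ^ 4)")
    case True
    have "real (CC n f \<mu> 0.49) \<le> 24 * (real k)\<^sup>2"
      by (rule CC_le_square[OF \<mu> k20 _ True]) (use \<open>\<lceil>100 * L\<rceil> \<le> int k\<close> in \<open>auto simp: L_def\<close>)
    also have "\<dots> \<le> 62 * (real k)\<^sup>2" by simp
    finally show ?thesis .
  next
    case False
    then have "real n ^ 2 < 3000 * (real k + 1) ^ 4"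
      using n by (auto simp: not_le divide_simps split: if_splits)
    \<comment> \<open>3000 is at most 55^2 = 3025.\<close>
    also have "\<dots> \<le> (55 * (real k + 1)\<^sup>2)\<^sup>2"
      by (simp add: power_mult_distrib)
    finally have "real n < 55 * (real k + 1)\<^sup>2" by (rule power2_less_imp_less) simp
    moreover have "real (CC n f \<mu> 0.49) \<le> real n + 1"
      using CC_le_Suc_n[of "0.49" n f \<mu>] by simp
    \<comment> \<open>55 * (21/20)^2 < 61, and the extra bit is absorbed by \<open>k\<close>
      squared, which is at least 400; hence the constant 62.\<close>
    moreover have "(real k + 1)\<^sup>2 \<le> (21 / 20 * real k)\<^sup>2"
      using k20 by (intro power_mono) auto
    moreover have "400 \<le> (real k)\<^sup>2" using power_mono[of 20 "real k" 2] k20 by simp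
    ultimately show ?thesis by (simp add: power_mult_distrib power_divide)
  qed
  have "real k \<le> 100 * \<bar>L\<bar> + 20" unfolding k_def by linarith
  then have "(real k)\<^sup>2 \<le> (100 * \<bar>L\<bar> + 20)\<^sup>2" by (intro power_mono) auto
  \<comment> \<open>The cross term is bounded through the square of 100 * |L| - 20.\<close>
  also have "\<dots> \<le> 20000 * L\<^sup>2 + 800"
    using zero_le_power2[of "100 * \<bar>L\<bar> - 20"] by (simp add: power2_sum power2_diff power_mult_distrib)
  also have "\<dots> \<le> 20000 * (L\<^sup>2 * log 2 (real n)) + 800"
  proof -
    have "1 \<le> log 2 (real n)" using n by (simp add: le_log_iff)
    then show ?thesis using mult_left_mono[of 1 "log 2 (real n)" "L\<^sup>2"] by simp
  qed
  finally have "62 * (real k)\<^sup>2 \<le> 62 * (20000 * (L\<^sup>2 * log 2 (real n)) + 800)" by simp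
  moreover have "0 \<le> L\<^sup>2 * log 2 (real n)" using n by simp
  ultimately show ?thesis using CC unfolding L_def[symmetric] distrib_left by linarith
qed

theorem mainTheorem4:
  shows "\<exists>C::real.
    (\<forall>n f \<mu>. 2 \<le> n \<longrightarrow> is_product_distribution n \<mu> \<longrightarrow>
       real (CC n f \<mu> 0.49)
         \<le> C * ((log 2 (srec n f \<mu> (1 / real n ^ 2) (1 / real n ^ 2)))\<^sup>2 * log 2 (real n) + 1)) \<and>
    (\<forall>n f \<mu> (k::nat) (\<delta>::real). 2 \<le> n \<longrightarrow> is_product_distribution n \<mu> \<longrightarrow>
       20 \<le> k \<longrightarrow> 0 \<le> \<delta> \<longrightarrow> \<delta> \<le> 1 / (3000 * (real k + 1) ^ 4) \<longrightarrow>
       \<lceil>100 * log 2 (srec n f \<mu> \<delta> \<delta>)\<rceil> \<le> int k \<longrightarrow>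
       real (CC n f \<mu> 0.49) \<le> C * (real k)\<^sup>2)"
proof (intro exI[of _ 2000000] conjI allI impI)
  fix n :: nat and f \<mu> and k :: nat and \<delta> :: real
  assume "is_product_distribution n \<mu>" "20 \<le> k" "0 \<le> \<delta>" "\<delta> \<le> 1 / (3000 * (real k + 1) ^ 4)"
    "\<lceil>100 * log 2 (srec n f \<mu> \<delta> \<delta>)\<rceil> \<le> int k"
  from CC_le_square[OF this] have "real (CC n f \<mu> 0.49) \<le> 24 * (real k)\<^sup>2" .
  also have "\<dots> \<le> 2000000 * (real k)\<^sup>2" by simp
  finally show "real (CC n f \<mu> 0.49) \<le> 2000000 * (real k)\<^sup>2" .
qed (rule CC_le_log_srec)

end
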